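(* Let $G$ be a connected graph and let $x$ be a vertex of $G$. Then ${\rm gp}(G-x)\leq 2\,{\rm gp}(G)$. Moreover, the bound is sharp: there exist connected graphs $G$ and vertices $x$ of $G$ with ${\rm gp}(G-x)=2\,{\rm gp}(G)$.
   Context: All graphs are simple. For a graph $G$, $d_G(u,v)$ is the number of edges of a shortest $u,v$-path in $G$ (a geodesic); if $u,v$ lie in different components there is no such path. A set $X\subseteq V(G)$ is a general position set of $G$ if for every pair of distinct $u,v\in X$ and every shortest $u,v$-path $P$ in $G$ we have $V(P)\cap X=\{u,v\}$ (equivalently, no three vertices of $X$ lie on a common shortest path of $G$). The general position number ${\rm gp}(G)$ is the maximum cardinality of a general position set of $G$. $G-x$ denotes the subgraph induced by $V(G)\setminus\{x\}$; it may be disconnected. *)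

theory Defs
  imports "Graph_Theory.Digraph_Component" "Graph_Theory.Arc_Walk" "HOL-Library.Extended_Nat"
begin

text \<open>
  An undirected simple graph is a symmetric digraph without loops and parallel arcs: the edge
  \<open>uv\<close> is the pair of opposite arcs between \<open>u\<close> and \<open>v\<close>. The locale \<open>graph\<close> of the library is
  the finite case of the following one.
\<close>

locale simple_graph = loopfree_digraph + nomulti_digraph + sym_digraph

sublocale graph \<subseteq> simple_graph
  by unfold_locales

lemma graph_iff_finite_simple_graph:
  "graph G \<longleftrightarrow> simple_graph G \<and> finite (verts G) \<and> finite (arcs G)"
  by (auto simp: graph_def digraph_def pseudo_graph_def simple_graph_def fin_digraph_def
      fin_digraph_axioms_def loopfree_digraph_def)

definition shortest_path :: "('a, 'b) pre_digraph \<Rightarrow> 'a \<Rightarrow> 'b list \<Rightarrow> 'a \<Rightarrow> bool" where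
  "shortest_path G u p v \<longleftrightarrow>
     pre_digraph.apath G u p v \<and> (\<forall>q. pre_digraph.apath G u q v \<longrightarrow> length p \<le> length q)"

definition general_position_set :: "('a, 'b) pre_digraph \<Rightarrow> 'a set \<Rightarrow> bool" where
  "general_position_set G X \<longleftrightarrow>
     X \<subseteq> verts G \<and>
     (\<forall>u\<in>X. \<forall>v\<in>X. u \<noteq> v \<longrightarrow>
        (\<forall>p. shortest_path G u p v \<longrightarrow> set (pre_digraph.awalk_verts G u p) \<inter> X = {u, v}))"

text \<open>
  The values lie in \<^typ>\<open>enat\<close> so that infinite graphs, where no largest finite general position
  set need exist, are covered as well; for finite graphs the supremum is a maximum, see
  \<open>gp_number_finite\<close> below.
\<close>

definition gp_number :: "('a, 'b) pre_digraph \<Rightarrow> enat" where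
  "gp_number G =
     (SUP X \<in> {X. general_position_set G X}. if finite X then enat (card X) else \<infinity>)"

lemma gp_number_finite:
  assumes "finite (verts G)"
  shows "gp_number G = enat (Max (card ` {X. general_position_set G X}))"
proof -
  let ?S = "{X. general_position_set G X}"
  have sub: "?S \<subseteq> Pow (verts G)"
    by (auto simp: general_position_set_def)
  then have fin: "finite ?S"
    using assms by (meson finite_Pow_iff finite_subset)
  have "{} \<in> ?S"
    by (simp add: general_position_set_def)
  then have ne: "?S \<noteq> {}"
    by blast
  have "finite X" if "X \<in> ?S" for X
    using that sub assms by (meson PowD finite_subset subsetD)
  then have "(\<lambda>X. if finite X then enat (card X) else \<infinity>) ` ?S = enat ` card ` ?S"
    by (simp add: image_image)
  moreover have "Max (enat ` card ` ?S) = enat (Max (card ` ?S))"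
    using fin ne by (intro mono_Max_commute[symmetric]) (auto simp: mono_def)
  ultimately show ?thesis
    using fin ne by (auto simp: gp_number_def Sup_enat_def)
qed

end

theory Submission
  imports Defs
begin

text \<open>
  Let \<open>X\<close> be in general position in \<open>G - x\<close> and order \<open>X\<close> by letting \<open>v < w\<close> if \<open>v \<noteq> w\<close> lies on
  some geodesic of \<open>G\<close> from \<open>x\<close> to \<open>w\<close>. A chain \<open>z < v < w\<close> would put \<open>v\<close> on a geodesic from \<open>z\<close>
  to \<open>w\<close> that avoids \<open>x\<close>, so \<open>X\<close> splits into two antichains: its minimal and its non-minimal
  elements. An antichain \<open>Y \<subseteq> X\<close> is in general position in \<open>G\<close>: if \<open>v\<close> is inside a geodesic between
  \<open>u\<close> and \<open>w\<close>, all in \<open>Y\<close>, then this geodesic must contain \<open>x\<close>, and \<open>v < u\<close> or \<open>v < w\<close>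
  according to the side of \<open>x\<close> on which \<open>v\<close> lies. Equality holds for the path on five vertices and
  its middle vertex.
\<close>

section \<open>Geodesics as shortest walks\<close>

context wf_digraph
begin

lemma shorter_awalk_if_not_distinct:
  assumes "awalk u p v" "\<not> distinct (awalk_verts u p)"
  shows "\<exists>q. awalk u q v \<and> length q < length p"
proof -
  from awalk_not_distinct_decomp[OF assms] obtain q r s w where
    "p = q @ r @ s" "0 < length r" "awalk u q w" "awalk w s v"
    by blast
  then show ?thesis
    by (intro exI[of _ "q @ s"]) (simp add: awalk_appendI del: awalk_append_iff)
qed

lemma awalk_imp_apath_length_le:
  assumes "awalk u p v"
  shows "\<exists>q. apath u q v \<and> length q \<le> length p"
  using assms
proof (induction "length p" arbitrary: p rule: less_induct)
  case less
  show ?case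
  proof (cases "distinct (awalk_verts u p)")
    case True
    with less.prems show ?thesis by (auto simp: apath_def)
  next
    case False
    with less.prems shorter_awalk_if_not_distinct obtain q where "awalk u q v" "length q < length p"
      by blast
    with less.hyps[of q] show ?thesis by fastforce
  qed
qed

text \<open>Cutting out a closed subwalk shortens a walk, so a shortest walk is a path. Minimality
  can thus be tested on walks, which concatenate freely, whereas joining two paths may repeat a
  vertex.\<close>

lemma shortest_path_iff_awalk:
  "shortest_path G u p v \<longleftrightarrow> awalk u p v \<and> (\<forall>q. awalk u q v \<longrightarrow> length p \<le> length q)"
  unfolding shortest_path_def
  by (metis (no_types) apath_def awalk_imp_apath_length_le leD le_trans shorter_awalk_if_not_distinct)

lemma shortest_path_apath: "shortest_path G u p v \<Longrightarrow> apath u p v"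
  by (simp add: shortest_path_def)

lemma shortest_path_awalk: "shortest_path G u p v \<Longrightarrow> awalk u p v"
  by (simp add: shortest_path_iff_awalk)

lemma shortest_path_length_le: "shortest_path G u p v \<Longrightarrow> awalk u q v \<Longrightarrow> length p \<le> length q"
  by (simp add: shortest_path_iff_awalk)

lemma reachable_imp_shortest_path:
  assumes "u \<rightarrow>\<^sup>* v"
  shows "\<exists>p. shortest_path G u p v"
proof -
  from assms obtain p where "awalk u p v" by (auto simp: reachable_awalk)
  then have "\<exists>p. awalk u p v \<and> (\<forall>q. awalk u q v \<longrightarrow> length p \<le> length q)"
    by (rule ex_has_least_nat)
  then show ?thesis by (simp add: shortest_path_iff_awalk)
qed

text \<open>A shorter substitute for either half would shorten the whole walk.\<close>

lemma shortest_path_appendD: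
  assumes "shortest_path G u (p @ q) w" "awalk u p v" "awalk v q w"
  shows "shortest_path G u p v" "shortest_path G v q w"
proof -
  have "length p \<le> length p'" if "awalk u p' v" for p'
    using shortest_path_length_le[OF assms(1) awalk_appendI[OF that assms(3)]] by simp
  with assms(2) show "shortest_path G u p v" by (simp add: shortest_path_iff_awalk)
  have "length q \<le> length q'" if "awalk v q' w" for q'
    using shortest_path_length_le[OF assms(1) awalk_appendI[OF assms(2) that]] by simp
  with assms(3) show "shortest_path G v q w" by (simp add: shortest_path_iff_awalk)
qed

lemma shortest_path_decomp:
  assumes "shortest_path G u p w" "v \<in> set (awalk_verts u p)"
  obtains q r where "p = q @ r" "shortest_path G u q v" "shortest_path G v r w"
    "set (awalk_verts u p) = set (awalk_verts u q) \<union> set (awalk_verts v r)"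
  using awalk_decomp[OF shortest_path_awalk[OF assms(1)] assms(2)] assms(1)
  by (metis shortest_path_appendD set_awalk_verts_append)

text \<open>Both \<open>p\<close> and \<open>p'\<close> are geodesics from \<open>u\<close> to
  \<open>v\<close>, so exchanging them preserves the total length.\<close>

lemma shortest_path_replace_prefix:
  assumes "shortest_path G u (p @ q) w" "shortest_path G u p v" "shortest_path G v q w"
    and "shortest_path G u p' v"
  shows "shortest_path G u (p' @ q) w"
  using assms
  by (auto simp: shortest_path_iff_awalk simp del: awalk_append_iff
      intro: awalk_appendI order_trans[OF _ shortest_path_length_le[OF assms(1)]])

lemma compatible_del_vert: "compatible (del_vert x) G"
  by (simp add: compatible_def del_vert_simps)

text \<open>Deleting a vertex creates no new walks, so a geodesic that survives the deletion has no
  shorter competitor.\<close>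

lemma shortest_path_del_vert:
  assumes "shortest_path G u p v" "x \<notin> set (awalk_verts u p)"
  shows "shortest_path (del_vert x) u p v"
proof -
  interpret D: wf_digraph "del_vert x" by (rule wf_digraph_del_vert)
  note cas_eq = compatible_cas[OF compatible_del_vert[of x]]
  from assms have p: "awalk u p v" by (simp add: shortest_path_iff_awalk)
  with assms(2) have "D.awalk u p v"
    by (auto simp: pre_digraph.awalk_def del_vert_simps cas_eq set_awalk_verts_cas)
  moreover have "awalk u q v" if "D.awalk u q v" for q
    using that subgraph_del_vert by (rule subgraph_awalk_imp_awalk)
  ultimately show ?thesis
    using assms(1) by (simp add: shortest_path_iff_awalk D.shortest_path_iff_awalk)
qed

lemma awalk_verts_del_vert: "pre_digraph.awalk_verts (del_vert x) = awalk_verts"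
  by (rule compatible_awalk_verts[OF compatible_del_vert])

end

lemma general_position_setD:
  assumes "general_position_set G X" "u \<in> X" "v \<in> X" "u \<noteq> v"
    "shortest_path G u p v" "w \<in> set (pre_digraph.awalk_verts G u p)" "w \<in> X"
  shows "w = u \<or> w = v"
  using assms unfolding general_position_set_def by blast

section \<open>The order by geodesics from \<open>x\<close>: chains and antichains\<close>

context sym_digraph
begin

text \<open>By symmetry every arc has an opposite arc; traversing these backwards gives
  \<open>q\<close>.\<close>

lemma awalk_rev:
  assumes "awalk u p v"
  shows "\<exists>q. awalk v q u \<and> length q = length p \<and> set (awalk_verts v q) = set (awalk_verts u p)"
  using assms
proof (induction p arbitrary: u)
  case Nil
  then show ?case by (intro exI[of _ "[]"]) (auto simp: awalk_Nil_iff)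
next
  case (Cons e p)
  then have e: "e \<in> arcs G" "u = tail G e" and p: "awalk (head G e) p v"
    by (auto simp: awalk_Cons_iff)
  from Cons.IH[OF p] obtain q where q: "awalk v q (head G e)" "length q = length p"
    "set (awalk_verts v q) = set (awalk_verts (head G e) p)" by blast
  from e have "(head G e, tail G e) \<in> arcs_ends G"
    using sym_arcs by (auto simp: symmetric_conv arcs_ends_conv)
  then obtain e' where e': "e' \<in> arcs G" "tail G e' = head G e" "head G e' = tail G e"
    by (auto simp: arcs_ends_conv)
  then have w: "awalk (head G e) [e'] u"
    using e by (auto simp: awalk_simps)
  have "head G e \<in> set (awalk_verts (head G e) p)"
    using p by (rule hd_in_awalk_verts)
  with q e e' w show ?case
    using awalk_appendI[OF q(1) w] set_awalk_verts_append[OF q(1) w]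
    by (intro exI[of _ "q @ [e']"]) auto
qed

lemma shortest_path_rev:
  assumes "shortest_path G u p v"
  shows "\<exists>q. shortest_path G v q u \<and> set (awalk_verts v q) = set (awalk_verts u p)"
  using assms unfolding shortest_path_iff_awalk by (metis awalk_rev)

definition geodesically_below :: "'a \<Rightarrow> 'a \<Rightarrow> 'a \<Rightarrow> bool" where
  "geodesically_below x v w \<longleftrightarrow>
     v \<noteq> w \<and> (\<exists>p. shortest_path G x p w \<and> v \<in> set (awalk_verts x p))"

lemma no_geodesic_chain:
  assumes X: "general_position_set (del_vert x) X" and "z \<in> X" "v \<in> X" "w \<in> X"
    and zv: "geodesically_below x z v" and vw: "geodesically_below x v w"
  shows False
proof -
  from vw obtain p where "v \<noteq> w" and p: "shortest_path G x p w" "v \<in> set (awalk_verts x p)"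
    by (auto simp: geodesically_below_def)
  from p obtain p1 p2 where
    p12: "p = p1 @ p2" "shortest_path G x p1 v" "shortest_path G v p2 w"
    by (rule shortest_path_decomp)
  from zv obtain q where "z \<noteq> v" and q: "shortest_path G x q v" "z \<in> set (awalk_verts x q)"
    by (auto simp: geodesically_below_def)
  from q obtain q1 q2 where
    q12: "q = q1 @ q2" "shortest_path G x q1 z" "shortest_path G z q2 v"
    by (rule shortest_path_decomp)
  \<comment> \<open>The geodesics to \<open>v\<close> and to \<open>w\<close> are chosen
    independently. Replacing the part \<open>p1\<close> of the latter by \<open>q\<close> yields a
    single geodesic from \<open>x\<close> that meets \<open>z\<close>, then \<open>v\<close>, then
    \<open>w\<close>.\<close>
  have whole: "shortest_path G x (q1 @ (q2 @ p2)) w"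
    using shortest_path_replace_prefix[of x p1 p2 w v q] p p12 q q12(1) by simp
  have z_w: "awalk z (q2 @ p2) w"
    using p12 q12 by (blast intro: awalk_appendI shortest_path_awalk)
  then have sp: "shortest_path G z (q2 @ p2) w"
    using shortest_path_appendD(2) whole q12(2) shortest_path_awalk by blast
  have v_in: "v \<in> set (awalk_verts z (q2 @ p2))"
    using set_awalk_verts_append[of z q2 v p2 w] p12 q12 hd_in_awalk_verts(1)
      shortest_path_awalk by blast
  \<comment> \<open>A geodesic with equal ends is empty and visits only \<open>z\<close>, but this
    one also visits \<open>v\<close>.\<close>
  have "z \<noteq> w"
    using apath_nonempty_ends[OF shortest_path_apath[OF sp]] v_in \<open>z \<noteq> v\<close>
    by (cases "q2 @ p2 = []") auto
  have "x \<noteq> z"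
    using X \<open>z \<in> X\<close> by (auto simp: general_position_set_def del_vert_simps)
  \<comment> \<open>The whole geodesic starts at \<open>x\<close> and repeats no vertex, so
    \<open>x\<close> cannot recur after \<open>z\<close>.\<close>
  have "x \<notin> set (awalk_verts z (q2 @ p2))"
  proof
    assume x: "x \<in> set (awalk_verts z (q2 @ p2))"
    have last: "awlast x q1 = z" and hd: "awhd z (q2 @ p2) = z"
      using q12(2) z_w shortest_path_awalk awlast_if_cas awhd_if_cas by blast+
    have "x \<in> set (tl (awalk_verts z (q2 @ p2)))"
      using x hd \<open>x \<noteq> z\<close> by (cases "awalk_verts z (q2 @ p2)") auto
    moreover have "x \<in> set (awalk_verts x q1)"
      using q12(2) hd_in_awalk_verts(1) shortest_path_awalk by blast
    ultimately show False
      using apath_decomp_disjoint[OF shortest_path_apath[OF whole] refl, of x] last by simp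
  qed
  from shortest_path_del_vert[OF sp this] show False
    using general_position_setD[OF X \<open>z \<in> X\<close> \<open>w \<in> X\<close> \<open>z \<noteq> w\<close>, of "q2 @ p2" v]
      v_in \<open>v \<in> X\<close> \<open>z \<noteq> v\<close> \<open>v \<noteq> w\<close> by (simp add: awalk_verts_del_vert)
qed

lemma general_position_set_if_antichain:
  assumes X: "general_position_set (del_vert x) X" and "Y \<subseteq> X"
    and anti: "\<And>v w. v \<in> Y \<Longrightarrow> w \<in> Y \<Longrightarrow> \<not> geodesically_below x v w"
  shows "general_position_set G Y"
  unfolding general_position_set_def
proof (intro conjI ballI impI allI)
  show "Y \<subseteq> verts G"
    using X \<open>Y \<subseteq> X\<close> by (auto simp: general_position_set_def del_vert_simps)
  fix u w p assume uw: "u \<in> Y" "w \<in> Y" "u \<noteq> w" and p: "shortest_path G u p w"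
  have "v = u \<or> v = w" if v: "v \<in> set (awalk_verts u p)" "v \<in> Y" for v
  proof (cases "x \<in> set (awalk_verts u p)")
    case False
    with p have "shortest_path (del_vert x) u p w" by (rule shortest_path_del_vert)
    with X uw v \<open>Y \<subseteq> X\<close> show ?thesis
      by (intro general_position_setD[of "del_vert x" X u w p v])
        (auto simp: awalk_verts_del_vert)
  next
    case True
    with p obtain q r where qr: "shortest_path G u q x" "shortest_path G x r w"
      "set (awalk_verts u p) = set (awalk_verts u q) \<union> set (awalk_verts x r)"
      by (rule shortest_path_decomp)
    \<comment> \<open>Reversing the first half makes both halves geodesics that start at
      \<open>x\<close>, as the order requires. A vertex \<open>v\<close> on the first half is
      \<open>u\<close> or below \<open>u\<close>; on the second it is \<open>w\<close> or below
      \<open>w\<close>.\<close>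
    obtain q' where q': "shortest_path G x q' u" "set (awalk_verts x q') = set (awalk_verts u q)"
      using shortest_path_rev[OF qr(1)] by blast
    then show ?thesis
      using anti[OF v(2) uw(1)] anti[OF v(2) uw(2)] qr v(1)
      by (auto simp: geodesically_below_def)
  qed
  moreover have "u \<in> set (awalk_verts u p)" "w \<in> set (awalk_verts u p)"
    using shortest_path_awalk[OF p] by (auto simp: hd_in_awalk_verts)
  ultimately show "set (awalk_verts u p) \<inter> Y = {u, w}"
    using uw by blast
qed

end

section \<open>The upper bound for vertex deletion\<close>

lemma gp_number_ge:
  assumes "general_position_set G X"
  shows "(if finite X then enat (card X) else \<infinity>) \<le> gp_number G"
  unfolding gp_number_def using assms by (intro SUP_upper) simp

lemma gp_number_leI:
  assumes "\<And>X. general_position_set G X \<Longrightarrow> (if finite X then enat (card X) else \<infinity>) \<le> k"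
  shows "gp_number G \<le> k"
  unfolding gp_number_def using assms by (intro SUP_least) simp

lemma (in sym_digraph) gp_number_del_vert_le:
  "gp_number (del_vert x) \<le> 2 * gp_number G"
proof (rule gp_number_leI)
  fix X assume X: "general_position_set (del_vert x) X"
  define B where "B = {w \<in> X. \<exists>v \<in> X. geodesically_below x v w}"
  define A where "A = X - B"
  have "general_position_set G A"
    using X by (rule general_position_set_if_antichain) (auto simp: A_def B_def)
  note A = gp_number_ge[OF this]
  have "general_position_set G B"
    using X
  proof (rule general_position_set_if_antichain)
    show "B \<subseteq> X" by (auto simp: B_def)
    \<comment> \<open>Some element of \<open>X\<close> lies below \<open>v\<close>, so
      \<open>v\<close> below \<open>w\<close> would complete a chain of three.\<close>
    show "\<not> geodesically_below x v w" if "v \<in> B" "w \<in> B" for v w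
      using that no_geodesic_chain[OF X] by (auto simp: B_def)
  qed
  note B = gp_number_ge[OF this]
  have union: "X = A \<union> B" "A \<inter> B = {}" by (auto simp: A_def B_def)
  show "(if finite X then enat (card X) else \<infinity>) \<le> 2 * gp_number G"
  proof (cases "finite X")
    case True
    then have fin: "finite A" "finite B" using union by auto
    then have "enat (card X) = enat (card A) + enat (card B)"
      using union by (simp add: card_Un_disjoint)
    also have "\<dots> \<le> gp_number G + gp_number G"
      using A B fin by (intro add_mono) auto
    finally show ?thesis using True by (simp add: mult_2)
  next
    case False
    \<comment> \<open>One infinite antichain already makes the right-hand side infinite.\<close>
    then have "infinite A \<or> infinite B" using union by auto
    then have "gp_number G = \<infinity>" using A B by (auto split: if_splits)
    then show ?thesis by (simp add: mult_2)
  qed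
qed

section \<open>Sharpness: paths and the deletion of a middle vertex\<close>

definition path_graph :: "nat \<Rightarrow> (nat, nat \<times> nat) pre_digraph" where
  "path_graph n =
     \<lparr>verts = {..<n}, arcs = {(i, j). i < n \<and> j < n \<and> (j = Suc i \<or> i = Suc j)},
      tail = fst, head = snd\<rparr>"

lemma path_graph_simps [simp]:
  "verts (path_graph n) = {..<n}"
  "arcs (path_graph n) = {(i, j). i < n \<and> j < n \<and> (j = Suc i \<or> i = Suc j)}"
  "tail (path_graph n) = fst" "head (path_graph n) = snd"
  by (simp_all add: path_graph_def)

lemma arcs_ends_path_graph: "arcs_ends (path_graph n) = arcs (path_graph n)"
  by (auto simp: arcs_ends_conv image_iff)

lemma graph_path_graph: "graph (path_graph n)"
proof -
  have "finite (arcs (path_graph n))"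
    by (rule finite_subset[of _ "{..<n} \<times> {..<n}"]) auto
  moreover have "symmetric (path_graph n)"
    unfolding symmetric_def arcs_ends_path_graph by (auto simp: sym_def)
  ultimately show ?thesis
    by unfold_locales (auto simp: arc_to_ends_def)
qed

interpretation path_graph: graph "path_graph n" for n
  by (rule graph_path_graph)

lemma path_graph_reachable_0: "i < n \<Longrightarrow> 0 \<rightarrow>\<^sup>*\<^bsub>path_graph n\<^esub> i"
proof (induction i)
  case 0
  then show ?case by simp
next
  case (Suc i)
  then have "i \<rightarrow>\<^bsub>path_graph n\<^esub> Suc i"
    by (simp add: arcs_ends_path_graph)
  with Suc show ?case
    by (meson Suc_lessD path_graph.reachable_adj_trans)
qed

lemma path_graph_reachable: "i < n \<Longrightarrow> j < n \<Longrightarrow> i \<rightarrow>\<^sup>*\<^bsub>path_graph n\<^esub> j"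
  by (meson path_graph.reachable_trans path_graph.sym_arcs path_graph_reachable_0
      symmetric_reachable)

lemma connected_path_graph: "0 < n \<Longrightarrow> Digraph_Component.connected (path_graph n)"
  unfolding connected_def
  by (intro strongly_connectedI)
    (auto intro: path_graph.reachable_mk_symmetricI path_graph_reachable)

text \<open>A discrete intermediate value argument: each arc changes the vertex by one, so a walk
  cannot jump over \<open>w\<close>.\<close>

lemma path_graph_awalk_between:
  assumes "pre_digraph.awalk (path_graph n) u p v" "u \<le> w" "w \<le> v"
  shows "w \<in> set (pre_digraph.awalk_verts (path_graph n) u p)"
  using assms
proof (induction p arbitrary: u)
  case Nil
  then show ?case by (auto simp: path_graph.awalk_Nil_iff pre_digraph.awalk_verts.simps)
next
  case (Cons e p)
  then show ?case
    by (cases "u = w") (auto simp: path_graph.awalk_Cons_iff pre_digraph.awalk_verts.simps)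
qed

lemma gp_number_path_graph_le: "gp_number (path_graph n) \<le> 2"
proof (rule gp_number_leI)
  fix X assume X: "general_position_set (path_graph n) X"
  then have sub: "X \<subseteq> {..<n}" by (simp add: general_position_set_def)
  then have fin: "finite X" by (rule finite_subset) simp
  \<comment> \<open>A geodesic between the two extremes passes through every element of
    \<open>X\<close>. For empty \<open>X\<close> the values of \<open>Min\<close> and
    \<open>Max\<close> are unspecified, but the inclusion is trivial.\<close>
  have "X \<subseteq> {Min X, Max X}"
  proof
    fix b assume b: "b \<in> X"
    with fin have mem: "Min X \<in> X" "Max X \<in> X" and le: "Min X \<le> b" "b \<le> Max X"
      by (auto intro: Min_in Max_in)
    show "b \<in> {Min X, Max X}"
    proof (cases "Min X = Max X")
      case True
      with le show ?thesis by simp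
    next
      case False
      obtain p where p: "shortest_path (path_graph n) (Min X) p (Max X)"
        using path_graph_reachable path_graph.reachable_imp_shortest_path mem sub by blast
      from path_graph_awalk_between[OF path_graph.shortest_path_awalk[OF p] le]
      show ?thesis using general_position_setD[OF X mem False p _ b] by blast
    qed
  qed
  then have "card X \<le> card {Min X, Max X}" by (rule card_mono[rotated]) simp
  also have "\<dots> \<le> 2" by (simp add: card_insert_if)
  finally show "(if finite X then enat (card X) else \<infinity>) \<le> 2"
    using fin by (simp add: numeral_eq_enat)
qed

text \<open>What remains is two disjoint edges, on \<open>{0, 1}\<close> and \<open>{3, 4}\<close>.
  A geodesic stays within one edge, so all four vertices together are in general position.\<close>

lemma gp_number_path_graph_5_del_vert_ge:
  "4 \<le> gp_number (pre_digraph.del_vert (path_graph 5) 2)"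
proof -
  let ?H = "pre_digraph.del_vert (path_graph 5) 2"
  interpret H: wf_digraph ?H by (rule path_graph.wf_digraph_del_vert)
  \<comment> \<open>Every arc crossing between the two sides of \<open>2\<close> would have to use
    \<open>2\<close> itself, so the test \<open>< 2\<close> is constant along walks.\<close>
  have arc_side: "snd e < 2 \<longleftrightarrow> fst e < 2" if "e \<in> arcs ?H" for e
    using that by (auto simp: path_graph.del_vert_simps)
  have same_side: "w < 2 \<longleftrightarrow> u < 2"
    if "H.awalk u p v" "w \<in> set (H.awalk_verts u p)" for u p v w
    using that
  proof (induction p arbitrary: u)
    case Nil
    then show ?case by (simp add: pre_digraph.awalk_verts.simps)
  next
    case (Cons e p)
    then have "e \<in> arcs ?H" "u = fst e" "H.awalk (snd e) p v"
      "w = u \<or> w \<in> set (H.awalk_verts (snd e) p)"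
      by (auto simp: H.awalk_Cons_iff path_graph.del_vert_simps pre_digraph.awalk_verts.simps)
    with Cons.IH[of "snd e"] arc_side[of e] show ?case by blast
  qed
  have "general_position_set ?H (verts ?H)"
    unfolding general_position_set_def
  proof (intro conjI ballI impI allI)
    fix u v p assume uv: "u \<in> verts ?H" "v \<in> verts ?H" "u \<noteq> v"
      and "shortest_path ?H u p v"
    then have p: "H.awalk u p v" by (simp add: H.shortest_path_iff_awalk)
    then have ends: "u \<in> set (H.awalk_verts u p)" "v \<in> set (H.awalk_verts u p)"
      by (auto simp: H.hd_in_awalk_verts)
    have "w = u \<or> w = v" if w: "w \<in> set (H.awalk_verts u p)" "w \<in> verts ?H" for w
    proof -
      have "w < 2 \<longleftrightarrow> u < 2" "v < 2 \<longleftrightarrow> u < 2"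
        using same_side[OF p] w(1) ends(2) by blast+
      moreover have "i < 5 \<and> i \<noteq> 2" if "i \<in> verts ?H" for i
        using that by (simp add: path_graph.del_vert_simps)
      from this[OF uv(1)] this[OF uv(2)] this[OF w(2)]
      have "u < 5" "u \<noteq> 2" "v < 5" "v \<noteq> 2" "w < 5" "w \<noteq> 2" by simp_all
      ultimately show ?thesis using uv(3) by presburger
    qed
    \<comment> \<open>Each side has just two vertices, so the distinct ends \<open>u\<close> and
      \<open>v\<close> exhaust theirs.\<close>
    then show "set (H.awalk_verts u p) \<inter> verts ?H = {u, v}"
      using uv(1,2) ends by blast
  qed simp
  moreover have "finite (verts ?H)" "card (verts ?H) = 4"
    by (simp_all add: path_graph.del_vert_simps)
  ultimately show ?thesis
    using gp_number_ge[of ?H "verts ?H"] by (simp add: numeral_eq_enat)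
qed

theorem theorem3p1:
  shows "(\<forall>(G :: ('a, 'b) pre_digraph) x.
            simple_graph G \<and> Digraph_Component.connected G \<and> x \<in> verts G \<longrightarrow>
            gp_number (pre_digraph.del_vert G x) \<le> 2 * gp_number G) \<and>
         (\<exists>(G :: (nat, nat \<times> nat) pre_digraph) x.
            graph G \<and> Digraph_Component.connected G \<and> x \<in> verts G \<and>
            gp_number (pre_digraph.del_vert G x) = 2 * gp_number G)"
proof (intro conjI allI impI)
  fix G :: "('a, 'b) pre_digraph" and x
  assume "simple_graph G \<and> Digraph_Component.connected G \<and> x \<in> verts G"
  then interpret simple_graph G by simp
  show "gp_number (del_vert x) \<le> 2 * gp_number G" by (rule gp_number_del_vert_le)
next
  \<comment> \<open>The estimates for the path give only one inequality, with \<open>4\<close> in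
    between; the reverse one is the general bound.\<close>
  have "2 * gp_number (path_graph 5) \<le> 2 * 2"
    using gp_number_path_graph_le by (rule mult_left_mono) simp
  also have "\<dots> \<le> gp_number (pre_digraph.del_vert (path_graph 5) 2)"
    using gp_number_path_graph_5_del_vert_ge by simp
  finally have "gp_number (pre_digraph.del_vert (path_graph 5) 2) = 2 * gp_number (path_graph 5)"
    by (intro antisym path_graph.gp_number_del_vert_le)
  then show "\<exists>(G :: (nat, nat \<times> nat) pre_digraph) x.
      graph G \<and> Digraph_Component.connected G \<and> x \<in> verts G \<and>
      gp_number (pre_digraph.del_vert G x) = 2 * gp_number G"
    using graph_path_graph[of 5] connected_path_graph[of 5]
    by (intro exI[of _ "path_graph 5"] exI[of _ 2]) simp
qed

end
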